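(* Suppose $f\in\mathcal{O}^\ast$ and $\alpha>1$. Suppose there exist $k$ points $w_1,\dots,w_k\in\mathbb{D}$ and $k$ numbers $c_1,\dots,c_k\in\mathbb{C}$ such that \[ f^\alpha(z)=\sum_{i=1}^kc_i\frac{1}{(1-\overline{w_i}z)^\alpha},\quad z\in\mathbb{D}. \] Fix a holomorphic function $g$ on $\mathbb{D}$ with $f^\alpha(z)=e^{g(z)}$ and put $\log f^\alpha(w_i)=g(w_i)$. Then \[ \frac{\partial}{\partial\alpha}N_f(\alpha)=\frac{1}{2\alpha^2}N_f^{1-2\alpha}(\alpha)D_f(\alpha), \] where \[ D_f(\alpha)=\sum_{i,j=1}^kc_i\overline{c_j}\frac{1}{(1-\overline{w_i}w_j)^\alpha}\Big(\overline{\log f^\alpha(w_i)}+\log f^\alpha(w_j)+\alpha\,\mathrm{Log}(1-\overline{w_i}w_j)-2\alpha\,\mathrm{Log}\,N_f(\alpha)\Big). \]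
   Context: $\mathbb{D}$ is the open unit disc in $\mathbb{C}$. $\mathcal{O}^\ast$ is the set of functions $f$ holomorphic in some open neighborhood of $\overline{\mathbb{D}}$ with $f(z)\ne0$ for all $z\in\overline{\mathbb{D}}$. For $\alpha>1$, \[ N_f(\alpha)=\Big(\int_{\mathbb{D}}|f(z)|^{2\alpha}(\alpha-1)(1-|z|^2)^{\alpha-2}\,\frac{dx\,dy}{\pi}\Big)^{\frac{1}{2\alpha}}, \] and $\frac{\partial}{\partial\alpha}N_f(\alpha)$ is its derivative in $\alpha$ with $f$ fixed. $N_f^{s}(\alpha)$ means $(N_f(\alpha))^{s}$. $\mathrm{Log}$ is the branch of the logarithm on $\mathbb{C}\setminus(-\infty,0]$ with $\mathrm{Log}\,1=0$, and powers $(1-\overline{w}z)^\alpha$ use this branch. $f^\alpha$ denotes $e^{\alpha h}$, where $h$ is a holomorphic function on $\mathbb{D}$ with $f=e^h$. *)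

theory Defs
  imports "HOL-Complex_Analysis.Complex_Analysis"
begin

definition Ostar :: "(complex \<Rightarrow> complex) set" where
  "Ostar = {f. (\<exists>U. open U \<and> cball 0 1 \<subseteq> U \<and> f holomorphic_on U) \<and> (\<forall>z\<in>cball 0 1. f z \<noteq> 0)}"

text \<open>Meaningful for \<open>\<alpha> > 1\<close>; the measure \<open>lborel\<close> on the complex numbers is \<open>dx dy\<close>.\<close>

definition N :: "(complex \<Rightarrow> complex) \<Rightarrow> real \<Rightarrow> real" where
  "N f \<alpha> = (LINT z:ball 0 1|lborel.
      cmod (f z) powr (2 * \<alpha>) * (\<alpha> - 1) * (1 - (cmod z)\<^sup>2) powr (\<alpha> - 2) / pi) powr (1 / (2 * \<alpha>))"

text \<open>The library's complex \<open>powr\<close> and \<open>Ln\<close> use the principal branch (imaginary part in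
  \<open>(-\<pi>, \<pi>]\<close>), which is \<open>Log\<close> on the plane slit along the nonpositive reals.  The points
  \<open>1 - cnj (w i) * w j\<close> lie in the right half-plane when all \<open>w i\<close> are in the unit disc.
  The function \<open>g\<close> is a holomorphic logarithm of \<open>f\<^sup>\<alpha>\<close>; the value does not change when a
  multiple of \<open>2\<pi>\<i>\<close> is added to it.\<close>

definition D :: "(complex \<Rightarrow> complex) \<Rightarrow> real \<Rightarrow> nat \<Rightarrow> (nat \<Rightarrow> complex) \<Rightarrow> (nat \<Rightarrow> complex)
    \<Rightarrow> (complex \<Rightarrow> complex) \<Rightarrow> complex" where
  "D f \<alpha> k c w g =
    (\<Sum>i=1..k. \<Sum>j=1..k. c i * cnj (c j) * (1 / (1 - cnj (w i) * w j) powr of_real \<alpha>) *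
      (cnj (g (w i)) + g (w j) + of_real \<alpha> * Ln (1 - cnj (w i) * w j)
        - 2 * of_real \<alpha> * Ln (of_real (N f \<alpha>))))"

end

theory Submission imports Defs begin

text \<open>
  Let \<open>M\<^sub>\<beta>\<close> be the probability measure \<open>(\<beta> - 1) (1 - |z|\<^sup>2)\<^bsup>\<beta>-2\<^esup> dx dy / \<pi>\<close> on the disc,
  write \<open>f = e\<^sup>h\<close>, and put \<open>Q(\<beta>) = \<integral> |e\<^bsup>\<beta>h\<^esup>|\<^sup>2 dM\<^sub>\<beta>\<close>, so that \<open>N f \<beta> = Q(\<beta>)\<^bsup>1/(2\<beta>)\<^esup>\<close>.  Everything
  comes down to \<open>Q'(\<alpha>)\<close>, and this derivative can be found without differentiating under the
  integral sign.

  The function \<open>K\<^bsub>\<beta>,w\<^esub>(z) = (1 - cnj w z)\<^bsup>-\<beta>\<^esup>\<close> reproduces point values: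
  \<open>\<integral> F cnj K\<^bsub>\<beta>,w\<^esub> dM\<^sub>\<beta> = F(w)\<close> (\<open>bergman_reproducing\<close>).  For \<open>\<beta>\<close> near \<open>\<alpha>\<close> compare
  \<open>F\<^sub>\<beta> = e\<^bsup>\<beta>h\<^esup>\<close> with \<open>G\<^sub>\<beta> = \<Sum> c\<^sub>i K\<^bsub>\<beta>,w\<^sub>i\<^esub>\<close>.  Expanding the square (\<open>integral_norm_squared_expand\<close>)
  gives
  \<open>Q(\<beta>) = 2 Re \<Sum>\<^sub>j cnj c\<^sub>j F\<^sub>\<beta>(w\<^sub>j) - \<Sum>\<^sub>i\<^sub>j c\<^sub>i cnj c\<^sub>j K\<^bsub>\<beta>,w\<^sub>i\<^esub>(w\<^sub>j) + \<integral> |F\<^sub>\<beta> - G\<^sub>\<beta>|\<^sup>2 dM\<^sub>\<beta>\<close>.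
  The hypothesis says \<open>F\<^sub>\<alpha> = G\<^sub>\<alpha>\<close>, and both families are Lipschitz in \<open>\<beta>\<close>, uniformly on the
  disc, so the last integral is \<open>O((\<beta> - \<alpha>)\<^sup>2)\<close> (\<open>kernel_sum_distance_quadratic\<close>).  Hence \<open>Q'(\<alpha>)\<close> is the
  derivative of the two finite sums, which are elementary functions of \<open>\<beta>\<close>
  (\<open>bergman_integral_derivative\<close>).  The theorem then follows by differentiating
  \<open>Q\<^bsup>1/(2\<beta>)\<^esup>\<close>.

  The reproducing property is proved by power series: the monomials are orthogonal because
  \<open>M\<^sub>\<beta>\<close> is invariant under rotations, their squared norms are Beta integrals, and these are exactly the
  reciprocals of the binomial coefficients of \<open>(1 - x)\<^bsup>-\<beta>\<^esup>\<close>.  Membership in \<open>Ostar\<close> lets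
  \<open>h\<close> extend to a larger disc, which makes all series converge absolutely up to the unit circle
  and makes \<open>h\<close> bounded.
\<close>

section \<open>Invariance of Lebesgue measure under orthogonal maps\<close>

lemma nn_integral_lborel_translate:
  fixes F :: "'a::euclidean_space \<Rightarrow> ennreal"
  assumes [measurable]: "F \<in> borel_measurable borel"
  shows "(\<integral>\<^sup>+x. F (x + c) \<partial>lborel) = (\<integral>\<^sup>+x. F x \<partial>lborel)"
proof -
  have "(\<integral>\<^sup>+x. F x \<partial>lborel) = (\<integral>\<^sup>+x. F x \<partial>distr lborel borel ((+) c))"
    by (simp add: lborel_distr_plus)
  also have "\<dots> = (\<integral>\<^sup>+x. F (x + c) \<partial>lborel)"
    by (subst nn_integral_distr) (auto simp: add.commute)
  finally show ?thesis by simp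
qed

lemma nn_integral_lborel_reflect_translate:
  fixes F :: "'a::euclidean_space \<Rightarrow> ennreal"
  assumes [measurable]: "F \<in> borel_measurable borel"
  shows "(\<integral>\<^sup>+x. F (c - x) \<partial>lborel) = (\<integral>\<^sup>+x. F x \<partial>lborel)"
proof -
  have "(lborel :: 'a measure) = distr lborel borel (\<lambda>x. c + (-1) *\<^sub>R x)"
    using lborel_affine[of "-1" c] by (simp add: density_1)
  hence "(\<integral>\<^sup>+x. F x \<partial>lborel) = (\<integral>\<^sup>+x. F x \<partial>distr lborel borel (\<lambda>x. c + (-1) *\<^sub>R x))"
    by simp
  also have "\<dots> = (\<integral>\<^sup>+x. F (c - x) \<partial>lborel)"
    by (subst nn_integral_distr) auto
  finally show ?thesis by simp
qed

text \<open>The argument behind the uniqueness of Haar measure.  Let \<open>g\<close> be the indicator of the unit ball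
  and \<open>V\<close> its volume.  Then \<open>V \<integral> F(\<rho> y) dy = \<integral>\<integral> F(\<rho> y) g(\<rho> y - x) dx dy\<close>; exchanging the integrals
  and translating \<open>y\<close> by the preimage of \<open>x\<close> turns this into \<open>\<integral>\<integral> F(\<rho> y + x) g(y) dx dy = V \<integral> F\<close>,
  where \<open>g(\<rho> y) = g(y)\<close> because \<open>\<rho>\<close> preserves the norm.\<close>

lemma nn_integral_lborel_orthogonal:
  fixes \<rho> :: "'a::euclidean_space \<Rightarrow> 'a" and F :: "'a \<Rightarrow> ennreal"
  assumes orth: "orthogonal_transformation \<rho>" and F[measurable]: "F \<in> borel_measurable borel"
  shows "(\<integral>\<^sup>+x. F (\<rho> x) \<partial>lborel) = (\<integral>\<^sup>+x. F x \<partial>lborel)"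
proof -
  have lin: "linear \<rho>"
    using orth by (rule orthogonal_transformation_linear)
  have [measurable]: "\<rho> \<in> borel_measurable borel"
    by (intro borel_measurable_continuous_onI linear_continuous_on linear_conv_bounded_linear[THEN iffD1] lin)
  define V where "V = emeasure lborel (ball (0::'a) 1)"
  have V: "V \<noteq> 0" "V \<noteq> \<infinity>"
    using less_imp_neq[OF unit_ball_vol_pos[of "real DIM('a)"]] by (auto simp: V_def emeasure_ball)
  define g :: "'a \<Rightarrow> ennreal" where "g = indicator (ball 0 1)"
  have [measurable]: "g \<in> borel_measurable borel"
    unfolding g_def by (intro borel_measurable_indicator) simp
  have gV: "(\<integral>\<^sup>+x. g x \<partial>lborel) = V"
    by (simp add: V_def g_def)
  have reflect: "(\<integral>\<^sup>+x. g (c - x) \<partial>lborel) = V" for c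
    by (subst nn_integral_lborel_reflect_translate[where F = g]) (auto simp: gV)
  have "(\<integral>\<^sup>+y. F (\<rho> y) \<partial>lborel) * V = (\<integral>\<^sup>+y. F (\<rho> y) * (\<integral>\<^sup>+x. g (\<rho> y - x) \<partial>lborel) \<partial>lborel)"
    unfolding reflect by (rule nn_integral_multc[symmetric]) simp
  also have "\<dots> = (\<integral>\<^sup>+y. (\<integral>\<^sup>+x. F (\<rho> y) * g (\<rho> y - x) \<partial>lborel) \<partial>lborel)"
    by (subst nn_integral_cmult[symmetric]) auto
  also have "\<dots> = (\<integral>\<^sup>+x. (\<integral>\<^sup>+y. F (\<rho> y) * g (\<rho> y - x) \<partial>lborel) \<partial>lborel)"
    by (rule lborel_pair.Fubini') simp
  also have "\<dots> = (\<integral>\<^sup>+x. (\<integral>\<^sup>+y. F (\<rho> y + x) * g y \<partial>lborel) \<partial>lborel)"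
  proof (rule nn_integral_cong)
    fix x :: 'a
    obtain x' where x': "x = \<rho> x'"
      using orthogonal_transformation_surj[OF orth] by (metis surjD)
    have "(\<integral>\<^sup>+y. F (\<rho> y) * g (\<rho> y - x) \<partial>lborel)
        = (\<integral>\<^sup>+y. F (\<rho> (y + x')) * g (\<rho> (y + x') - x) \<partial>lborel)"
      by (rule nn_integral_lborel_translate[symmetric]) simp
    also have "\<dots> = (\<integral>\<^sup>+y. F (\<rho> y + x) * g y \<partial>lborel)"
      using orthogonal_transformation_norm[OF orth]
      by (intro nn_integral_cong) (auto simp: x' linear_add[OF lin] g_def indicator_def)
    finally show "(\<integral>\<^sup>+y. F (\<rho> y) * g (\<rho> y - x) \<partial>lborel) = (\<integral>\<^sup>+y. F (\<rho> y + x) * g y \<partial>lborel)" .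
  qed
  also have "\<dots> = (\<integral>\<^sup>+y. (\<integral>\<^sup>+x. F (x + \<rho> y) * g y \<partial>lborel) \<partial>lborel)"
    by (subst lborel_pair.Fubini') (auto simp: add.commute)
  also have "\<dots> = (\<integral>\<^sup>+y. (\<integral>\<^sup>+x. F x \<partial>lborel) * g y \<partial>lborel)"
    by (subst nn_integral_multc) (auto simp: nn_integral_lborel_translate)
  also have "\<dots> = (\<integral>\<^sup>+x. F x \<partial>lborel) * V"
    by (subst nn_integral_cmult) (auto simp: gV)
  finally show ?thesis
    using V by (simp add: mult.commute[of _ V] ennreal_mult_cancel_left)
qed

lemma lborel_distr_orthogonal:
  fixes \<rho> :: "'a::euclidean_space \<Rightarrow> 'a"
  assumes orth: "orthogonal_transformation \<rho>"
  shows "distr lborel borel \<rho> = lborel"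
proof (rule measure_eqI)
  have [measurable]: "\<rho> \<in> borel_measurable borel"
    by (intro borel_measurable_continuous_onI linear_continuous_on
          linear_conv_bounded_linear[THEN iffD1] orthogonal_transformation_linear orth)
  fix A assume "A \<in> sets (distr lborel borel \<rho>)"
  hence A[measurable]: "A \<in> sets borel" by simp
  have "emeasure (distr lborel borel \<rho>) A = (\<integral>\<^sup>+x. indicator A (\<rho> x) \<partial>lborel)"
    by (simp add: nn_integral_distr flip: nn_integral_indicator)
  thus "emeasure (distr lborel borel \<rho>) A = emeasure lborel A"
    by (simp add: nn_integral_lborel_orthogonal[OF orth])
qed simp

section \<open>The weighted Bergman measures on the disc\<close>

text \<open>The disc of radius \<open>\<surd>x\<close> has area \<open>\<pi> x\<close>, so \<open>|z|\<^sup>2\<close> is uniformly distributed.  This replaces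
  polar coordinates for radial integrands.\<close>

lemma distr_unit_disc_norm_squared:
  "distr (restrict_space lborel (ball (0::complex) 1)) borel (\<lambda>z. (cmod z)\<^sup>2)
     = density lborel (\<lambda>t. ennreal pi * indicator {0..1} t)" (is "?M = ?N")
proof (rule measure_eqI_lessThan)
  have meas[measurable]: "(\<lambda>z. (cmod z)\<^sup>2) \<in> borel_measurable (restrict_space lborel (ball (0::complex) 1))"
    by (intro measurable_restrict_space1) simp
  have M: "emeasure ?M {x<..} = emeasure lborel {z\<in>ball (0::complex) 1. x < (cmod z)\<^sup>2}" for x
    by (subst emeasure_distr)
       (auto simp: emeasure_restrict_space space_restrict_space vimage_def intro!: arg_cong[where f="emeasure lborel"])
  have N: "emeasure ?N {x<..} = ennreal pi * emeasure lborel ({0..1} \<inter> {x<..})" for x :: real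
  proof -
    have "emeasure ?N {x<..} = (\<integral>\<^sup>+t. ennreal pi * indicator ({0..1} \<inter> {x<..}) t \<partial>lborel)"
      by (subst emeasure_density) (auto intro!: nn_integral_cong simp: indicator_def)
    thus ?thesis by (simp add: nn_integral_cmult)
  qed
  have ball: "emeasure lborel (ball (0::complex) 1) = ennreal pi"
    by (simp add: emeasure_ball unit_ball_vol_2)
  show "emeasure ?M {x<..} < \<infinity>" for x
  proof -
    have "emeasure ?M {x<..} \<le> emeasure lborel (ball (0::complex) 1)"
      unfolding M by (rule emeasure_mono) auto
    also have "\<dots> < \<infinity>" by (simp add: ball)
    finally show ?thesis .
  qed
  show "emeasure ?M {x<..} = emeasure ?N {x<..}" for x
  proof -
    consider "x < 0" | "0 \<le> x" "x < 1" | "x \<ge> 1" by linarith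
    thus ?thesis
    proof cases
      case 1
      have "{z\<in>ball (0::complex) 1. x < (cmod z)\<^sup>2} = ball 0 1"
        using 1 by (auto intro: less_le_trans[of x 0 "(cmod _)\<^sup>2"])
      moreover have "{0..1} \<inter> {x<..} = {0..1}" using 1 by auto
      ultimately show ?thesis unfolding M N by (simp add: ball)
    next
      case 2
      have sqrt_less: "sqrt x < 1" using 2 by simp
      have "(x < (cmod z)\<^sup>2) \<longleftrightarrow> z \<notin> cball 0 (sqrt x)" for z
        using real_sqrt_less_iff[of x "(cmod z)\<^sup>2"] by (simp add: not_le)
      hence "{z\<in>ball (0::complex) 1. x < (cmod z)\<^sup>2} = ball 0 1 - cball 0 (sqrt x)"
        by blast
      moreover have "emeasure lborel (ball 0 1 - cball (0::complex) (sqrt x))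
          = emeasure lborel (ball (0::complex) 1) - emeasure lborel (cball (0::complex) (sqrt x))"
        using 2 le_less_trans[OF _ sqrt_less]
        by (intro emeasure_Diff) (auto simp: emeasure_cball)
      moreover have "\<dots> = ennreal (pi - pi * x)"
        using 2 by (simp add: ball emeasure_cball unit_ball_vol_2 ennreal_minus)
      moreover have "{0..1} \<inter> {x<..} = {x<..1}" using 2 by auto
      ultimately show ?thesis unfolding M N using 2
        by (simp add: algebra_simps flip: ennreal_mult)
    next
      case 3
      have "{z\<in>ball (0::complex) 1. x < (cmod z)\<^sup>2} = {}"
      proof -
        have "(cmod z)\<^sup>2 \<le> x" if "cmod z < 1" for z
          using 3 that power_le_one[of "cmod z" 2] by simp
        thus ?thesis by (auto simp: not_less) (meson linorder_not_le)
      qed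
      moreover have "{0..1} \<inter> {x<..} = {}" using 3 by auto
      ultimately show ?thesis unfolding M N by (simp only: emeasure_empty) simp
    qed
  qed
qed simp_all

lemma nn_integral_unit_disc_radial:
  fixes F :: "real \<Rightarrow> ennreal"
  assumes [measurable]: "F \<in> borel_measurable borel"
  shows "(\<integral>\<^sup>+z. F ((cmod z)\<^sup>2) \<partial>restrict_space lborel (ball 0 1))
       = ennreal pi * (\<integral>\<^sup>+t. indicator {0..1} t * F t \<partial>lborel)"
proof -
  have meas[measurable]: "(\<lambda>z. (cmod z)\<^sup>2) \<in> borel_measurable (restrict_space lborel (ball (0::complex) 1))"
    by (intro measurable_restrict_space1) simp
  have "(\<integral>\<^sup>+z. F ((cmod z)\<^sup>2) \<partial>restrict_space lborel (ball 0 1))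
      = (\<integral>\<^sup>+t. F t \<partial>density lborel (\<lambda>t. ennreal pi * indicator {0..1} t))"
    by (simp add: nn_integral_distr flip: distr_unit_disc_norm_squared)
  also have "\<dots> = (\<integral>\<^sup>+t. ennreal pi * (indicator {0..1} t * F t) \<partial>lborel)"
    by (subst nn_integral_density) (auto simp: mult.assoc)
  finally show ?thesis by (simp add: nn_integral_cmult)
qed

definition bergman_weight :: "real \<Rightarrow> real \<Rightarrow> real" where
  "bergman_weight \<beta> t = (\<beta> - 1) / pi * (1 - t) powr (\<beta> - 2)"

text \<open>The underlying space is the open disc itself, so that a function that is continuous there is
  measurable whatever its values elsewhere.\<close>

definition bergman :: "real \<Rightarrow> complex measure" where
  "bergman \<beta> = density (restrict_space lborel (ball 0 1))
     (\<lambda>z. ennreal (bergman_weight \<beta> ((cmod z)\<^sup>2)))"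

lemma measurable_bergman_weight [measurable]: "bergman_weight \<beta> \<in> borel_measurable borel"
  unfolding bergman_weight_def by measurable

lemma bergman_weight_nonneg: "\<beta> > 1 \<Longrightarrow> bergman_weight \<beta> t \<ge> 0"
  by (simp add: bergman_weight_def)

lemma measurable_norm_squared_restrict [measurable]:
  "(\<lambda>z::complex. (cmod z)\<^sup>2) \<in> borel_measurable (restrict_space lborel A)"
  by (intro measurable_restrict_space1) simp

lemma space_bergman [simp]: "space (bergman \<beta>) = ball 0 1"
  by (simp add: bergman_def space_restrict_space)

lemma measurable_bergman [simp]:
  "borel_measurable (bergman \<beta>) = borel_measurable (restrict_space borel (ball 0 1))"
  unfolding bergman_def by (intro measurable_cong_sets) (auto simp: sets_restrict_space)

lemma continuous_on_measurable_bergman: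
  "continuous_on (ball 0 1) F \<Longrightarrow> F \<in> borel_measurable (bergman \<beta>)"
  by (simp add: borel_measurable_continuous_on_restrict)

text \<open>Radial integration turns the moment into \<open>(\<beta> - 1) B(n + 1, \<beta> - 1)\<close>.  The case \<open>n = 0\<close> shows that
  the total mass is 1.\<close>

lemma nn_integral_bergman_moment:
  assumes "\<beta> > 1"
  shows "(\<integral>\<^sup>+z. ennreal (cmod z ^ (2 * n)) \<partial>bergman \<beta>) = ennreal (fact n / pochhammer \<beta> n)"
proof -
  have "(\<integral>\<^sup>+z. ennreal (cmod z ^ (2 * n)) \<partial>bergman \<beta>)
      = (\<integral>\<^sup>+z. ennreal (bergman_weight \<beta> ((cmod z)\<^sup>2)) * ennreal (((cmod z)\<^sup>2) ^ n)
          \<partial>restrict_space lborel (ball 0 1))"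
    unfolding bergman_def power_mult by (rule nn_integral_density) measurable
  also have "\<dots> = ennreal pi * (\<integral>\<^sup>+t. indicator {0..1} t *
      (ennreal (bergman_weight \<beta> t) * ennreal (t ^ n)) \<partial>lborel)"
    by (subst nn_integral_unit_disc_radial[symmetric]) auto
  also have "(\<integral>\<^sup>+t. indicator {0..1} t *
      (ennreal (bergman_weight \<beta> t) * ennreal (t ^ n)) \<partial>lborel)
      = (\<integral>\<^sup>+t. ennreal ((\<beta> - 1) / pi) *
          ennreal (indicator {0..1} t * (t powr (real n + 1 - 1) * (1 - t) powr (\<beta> - 1 - 1))) \<partial>lborel)"
  \<comment> \<open>The point \<open>t = 0\<close> is exceptional for \<open>n = 0\<close>: there \<open>t ^ 0 = 1\<close> but \<open>t powr 0 = 0\<close>.\<close>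
  proof (rule nn_integral_cong_AE, rule AE_mp[OF AE_lborel_singleton[of 0]], rule AE_I2, rule impI)
    fix t :: real assume "t \<noteq> 0"
    thus "indicator {0..1} t * (ennreal (bergman_weight \<beta> t) * ennreal (t ^ n))
      = ennreal ((\<beta> - 1) / pi) *
          ennreal (indicator {0..1} t * (t powr (real n + 1 - 1) * (1 - t) powr (\<beta> - 1 - 1)))"
      using assms by (auto simp: bergman_weight_def indicator_def powr_realpow mult_ac simp flip: ennreal_mult)
  qed
  also have "\<dots> = ennreal ((\<beta> - 1) / pi) * ennreal (Beta (real n + 1) (\<beta> - 1))"
  proof (subst nn_integral_cmult)
    have "((\<lambda>t. t powr (real n + 1 - 1) * (1 - t) powr (\<beta> - 1 - 1)) has_integral
        Beta (real n + 1) (\<beta> - 1)) {0..1}"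
      using assms by (intro has_integral_Beta_real) auto
    thus "ennreal ((\<beta> - 1) / pi) * (\<integral>\<^sup>+t. ennreal (indicator {0..1} t *
        (t powr (real n + 1 - 1) * (1 - t) powr (\<beta> - 1 - 1))) \<partial>lborel)
        = ennreal ((\<beta> - 1) / pi) * ennreal (Beta (real n + 1) (\<beta> - 1))"
      by (subst nn_integral_has_integral_lebesgue) auto
  qed simp
  also have "ennreal pi * \<dots> = ennreal ((\<beta> - 1) * Beta (real n + 1) (\<beta> - 1))"
    using assms by (simp add: mult.assoc[symmetric] flip: ennreal_mult' ennreal_mult'')
  also have "(\<beta> - 1) * Beta (real n + 1) (\<beta> - 1) = fact n / pochhammer \<beta> n"
  proof -
    have nonpos: "x \<notin> \<int>\<^sub>\<le>\<^sub>0" if "x > 0" for x :: real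
      using that by (auto elim!: nonpos_Ints_cases)
    have "Gamma \<beta> = (\<beta> - 1) * Gamma (\<beta> - 1)"
      using Gamma_plus1[of "\<beta> - 1"] nonpos[of "\<beta> - 1"] assms by simp
    moreover have "Gamma \<beta> > 0"
      using assms by (intro Gamma_real_pos) auto
    ultimately show ?thesis
      using assms nonpos[of \<beta>] pochhammer_Gamma[of \<beta> n] Gamma_fact[of n, where ?'a=real]
      by (simp add: Beta_def add_ac)
  qed
  finally show ?thesis .
qed

lemma emeasure_bergman_disc:
  "\<beta> > 1 \<Longrightarrow> emeasure (bergman \<beta>) (ball 0 1) = 1"
  using nn_integral_bergman_moment[of \<beta> 0] by simp

lemma finite_measure_bergman: "\<beta> > 1 \<Longrightarrow> finite_measure (bergman \<beta>)"
  by (rule finite_measureI) (simp add: emeasure_bergman_disc)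

lemma integral_bergman_eq:
  fixes F :: "complex \<Rightarrow> 'b::{banach, second_countable_topology}"
  assumes "\<beta> > 1" and F: "continuous_on (ball 0 1) F"
  shows "integral\<^sup>L (bergman \<beta>) F = 
    (LINT z|lborel. indicator (ball 0 1) z *\<^sub>R ((bergman_weight \<beta> ((cmod z)\<^sup>2)) *\<^sub>R F z))"
proof -
  have [measurable]: "F \<in> borel_measurable (restrict_space lborel (ball 0 1))"
    using borel_measurable_continuous_on_restrict[OF F]
    by (simp cong: measurable_cong_sets add: sets_restrict_space)
  show ?thesis
    using assms unfolding bergman_def
    by (subst integral_density) (auto simp: integral_restrict_space bergman_weight_nonneg)
qed

lemma integrable_bergman_bounded:
  fixes F :: "complex \<Rightarrow> 'b::{banach, second_countable_topology}"
  assumes "\<beta> > 1" and F: "continuous_on (ball 0 1) F" and B: "\<And>z. z \<in> ball 0 1 \<Longrightarrow> norm (F z) \<le> B"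
  shows "integrable (bergman \<beta>) F"
proof -
  interpret finite_measure "bergman \<beta>" by (rule finite_measure_bergman) fact
  show ?thesis
    using B by (intro integrable_const_bound[of _ B] AE_I2 continuous_on_measurable_bergman F) auto
qed

lemma integral_bergman_bounds:
  assumes "\<beta> > 1" and F: "continuous_on (ball 0 1) F"
    and lo: "\<And>z. z \<in> ball 0 1 \<Longrightarrow> A \<le> F z" and hi: "\<And>z. z \<in> ball 0 1 \<Longrightarrow> F z \<le> (B::real)"
  shows "A \<le> integral\<^sup>L (bergman \<beta>) F" and "integral\<^sup>L (bergman \<beta>) F \<le> B"
proof -
  interpret finite_measure "bergman \<beta>" by (rule finite_measure_bergman) fact
  have measure_disc: "measure (bergman \<beta>) (ball 0 1) = 1"
    by (simp add: measure_def emeasure_bergman_disc[OF \<open>\<beta> > 1\<close>])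
  have "norm (F z) \<le> max \<bar>A\<bar> \<bar>B\<bar>" if "z \<in> ball 0 1" for z
    using lo[OF that] hi[OF that] by (auto simp: abs_if max_def)
  hence int: "integrable (bergman \<beta>) F"
    using assms(1) F by (intro integrable_bergman_bounded)
  have "(LINT z|bergman \<beta>. A) \<le> integral\<^sup>L (bergman \<beta>) F"
    using int lo by (intro integral_mono) auto
  thus "A \<le> integral\<^sup>L (bergman \<beta>) F" by (simp add: measure_disc)
  have "integral\<^sup>L (bergman \<beta>) F \<le> (LINT z|bergman \<beta>. B)"
    using int hi by (intro integral_mono) auto
  thus "integral\<^sup>L (bergman \<beta>) F \<le> B" by (simp add: measure_disc)
qed

lemma integral_bergman_rotate:
  assumes "\<beta> > 1" and F: "continuous_on (ball 0 1) (F :: complex \<Rightarrow> complex)" and \<zeta>: "cmod \<zeta> = 1"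
  shows "(LINT z|bergman \<beta>. F (\<zeta> * z)) = (LINT z|bergman \<beta>. F z)"
proof -
  have "linear ((*) \<zeta>)"
    by (rule bounded_linear.linear) (rule bounded_linear_mult_right)
  hence orth: "orthogonal_transformation ((*) \<zeta>)"
    using \<zeta> by (simp add: orthogonal_transformation norm_mult)
  define W where "W = (\<lambda>z. bergman_weight \<beta> ((cmod z)\<^sup>2))"
  have "(\<lambda>z. indicator (ball 0 1) z *\<^sub>R F z) \<in> borel_measurable borel"
    using F by (intro borel_measurable_continuous_on_indicator) auto
  hence "(\<lambda>z. W z *\<^sub>R (indicator (ball 0 1) z *\<^sub>R F z)) \<in> borel_measurable borel"
    unfolding W_def by measurable
  hence meas: "(\<lambda>z. indicator (ball 0 1) z *\<^sub>R (W z *\<^sub>R F z)) \<in> borel_measurable borel"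
    by (simp add: scaleR_left_commute mult.commute mult.left_commute)
  have cont: "continuous_on (ball 0 1) (\<lambda>z. F (\<zeta> * z))"
    using \<zeta> by (intro continuous_on_compose2[OF F] continuous_intros) (auto simp: norm_mult)
  have "(LINT z|bergman \<beta>. F z) = (LINT z|distr lborel borel ((*) \<zeta>). indicator (ball 0 1) z *\<^sub>R (W z *\<^sub>R F z))"
    by (simp only: integral_bergman_eq[OF assms(1,2)] lborel_distr_orthogonal[OF orth] W_def)
  also have "\<dots> = (LINT z|lborel. indicator (ball 0 1) (\<zeta> * z) *\<^sub>R (W (\<zeta> * z) *\<^sub>R F (\<zeta> * z)))"
    by (rule integral_distr) (use meas in auto)
  also have "\<dots> = (LINT z|bergman \<beta>. F (\<zeta> * z))"
    using \<zeta> unfolding integral_bergman_eq[OF assms(1) cont]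
    by (intro Bochner_Integration.integral_cong) (auto simp: W_def norm_mult indicator_def)
  finally show ?thesis by simp
qed

text \<open>For \<open>m \<noteq> n\<close> the integrand is multiplied by \<open>\<zeta>\<^sup>m cnj \<zeta>\<^sup>n\<close> under the rotation by \<open>\<zeta>\<close>, while the integral
  is unchanged; the angle \<open>\<pi> / (m - n)\<close> makes that factor \<open>-1\<close>.\<close>

lemma integral_bergman_monomials:
  assumes "\<beta> > 1"
  shows "(LINT z|bergman \<beta>. z ^ m * cnj z ^ n)
       = (if m = n then of_real (fact n / pochhammer \<beta> n) else 0)"
proof (cases "m = n")
  case True
  have "(LINT z|bergman \<beta>. z ^ m * cnj z ^ n) = (LINT z|bergman \<beta>. complex_of_real (cmod z ^ (2 * n)))"
    unfolding True by (intro Bochner_Integration.integral_cong)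
      (auto simp: power_mult simp flip: power_mult_distrib complex_norm_square)
  also have "\<dots> = of_real (LINT z|bergman \<beta>. cmod z ^ (2 * n))"
    by (rule integral_complex_of_real)
  also have "(LINT z|bergman \<beta>. cmod z ^ (2 * n)) = fact n / pochhammer \<beta> n"
  proof (subst integral_eq_nn_integral)
    show "(\<lambda>z. cmod z ^ (2 * n)) \<in> borel_measurable (bergman \<beta>)"
      by (intro continuous_on_measurable_bergman continuous_intros)
    have "pochhammer \<beta> n > 0"
      using assms by (intro pochhammer_pos) auto
    thus "enn2real (\<integral>\<^sup>+z. ennreal (cmod z ^ (2 * n)) \<partial>bergman \<beta>) = fact n / pochhammer \<beta> n"
      by (simp add: nn_integral_bergman_moment[OF assms])
  qed auto
  finally show ?thesis using True by simp
next
  case False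
  define \<theta> where "\<theta> = pi / (real m - real n)"
  define T where "T = (LINT z|bergman \<beta>. z ^ m * cnj z ^ n)"
  have "cis \<theta> ^ m * cnj (cis \<theta>) ^ n = cis (real m * \<theta> + real n * (- \<theta>))"
    by (simp only: cis_cnj Complex.DeMoivre cis_mult)
  also have "real m * \<theta> + real n * (- \<theta>) = pi"
  proof -
    have "real m * \<theta> + real n * (- \<theta>) = (real m - real n) * \<theta>"
      by (simp add: algebra_simps)
    thus ?thesis using False by (simp add: \<theta>_def)
  qed
  finally have *: "cis \<theta> ^ m * cnj (cis \<theta>) ^ n = -1" by simp
  have "T = (LINT z|bergman \<beta>. (cis \<theta> * z) ^ m * cnj (cis \<theta> * z) ^ n)"
    unfolding T_def using assms
    by (intro integral_bergman_rotate[symmetric] continuous_intros) auto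
  also have "\<dots> = (LINT z|bergman \<beta>. (cis \<theta> ^ m * cnj (cis \<theta>) ^ n) * (z ^ m * cnj z ^ n))"
    by (intro Bochner_Integration.integral_cong refl) (simp only: complex_cnj_mult power_mult_distrib mult_ac)
  also have "\<dots> = - T"
    unfolding * T_def by simp
  finally show ?thesis using False by (simp add: T_def)
qed

section \<open>The reproducing kernels\<close>

lemma sums_integral_bergman:
  fixes f :: "nat \<Rightarrow> complex \<Rightarrow> complex"
  assumes \<beta>: "\<beta> > 1" and cont: "\<And>n. continuous_on (ball 0 1) (f n)"
    and bound: "\<And>n z. z \<in> ball 0 1 \<Longrightarrow> cmod (f n z) \<le> b n" and b: "summable b"
    and F: "\<And>z. z \<in> ball 0 1 \<Longrightarrow> (\<lambda>n. f n z) sums F z"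
  shows "(\<lambda>n. LINT z|bergman \<beta>. f n z) sums (LINT z|bergman \<beta>. F z)"
proof -
  interpret finite_measure "bergman \<beta>" by (rule finite_measure_bergman) fact
  have measure_disc: "measure (bergman \<beta>) (ball 0 1) = 1"
    by (simp add: measure_def emeasure_bergman_disc[OF \<beta>])
  have int: "integrable (bergman \<beta>) (f n)" for n
    using \<beta> cont bound by (rule integrable_bergman_bounded)
  have "(LINT z|bergman \<beta>. cmod (f n z)) \<le> (LINT z|bergman \<beta>. b n)" for n
    using bound int by (intro integral_mono) auto
  hence "norm (LINT z|bergman \<beta>. cmod (f n z)) \<le> b n" for n
    by (simp add: measure_disc)
  hence "summable (\<lambda>n. LINT z|bergman \<beta>. cmod (f n z))"
    by (intro summable_comparison_test'[OF b, of 0]) auto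
  moreover have "summable (\<lambda>n. cmod (f n z))" if "z \<in> ball 0 1" for z
    using bound[OF that] by (intro summable_comparison_test'[OF b, of 0]) auto
  ultimately have "(\<lambda>n. LINT z|bergman \<beta>. f n z) sums (LINT z|bergman \<beta>. (\<Sum>n. f n z))"
    by (intro sums_integral int AE_I2) auto
  also have "(LINT z|bergman \<beta>. (\<Sum>n. f n z)) = (LINT z|bergman \<beta>. F z)"
    using F by (intro Bochner_Integration.integral_cong) (auto simp: sums_unique[symmetric])
  finally show ?thesis .
qed

text \<open>Holomorphy slightly beyond the closed disc is what makes the Taylor coefficients themselves
  absolutely summable, so that term-by-term integration over the whole disc needs no limit of
  smaller discs.\<close>

lemma power_series_absolutely_summable:
  assumes "R > 1" and G: "G holomorphic_on ball 0 R"
  obtains a :: "nat \<Rightarrow> complex" where "summable (\<lambda>n. cmod (a n))"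
    and "\<And>z. z \<in> ball 0 1 \<Longrightarrow> (\<lambda>n. a n * z ^ n) sums G z"
proof
  define a where "a = (\<lambda>n. (deriv ^^ n) G 0 / fact n)"
  have sums: "(\<lambda>n. a n * z ^ n) sums G z" if "z \<in> ball 0 R" for z
    using holomorphic_power_series[OF G that] by (simp add: a_def)
  obtain r where r: "1 < r" "r < R" using dense[OF \<open>R > 1\<close>] by auto
  have "summable (\<lambda>n. a n * complex_of_real r ^ n)"
    using r by (intro sums_summable[OF sums]) auto
  from powser_insidea[OF this, of 1] r show "summable (\<lambda>n. cmod (a n))" by simp
  show "(\<lambda>n. a n * z ^ n) sums G z" if "z \<in> ball 0 1" for z
    using that \<open>R > 1\<close> by (intro sums) auto
qed

lemma bounded_on_unit_disc:
  assumes "R > 1" and G: "(G :: complex \<Rightarrow> complex) holomorphic_on ball 0 R"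
  obtains B where "B \<ge> 0" and "\<And>z. z \<in> ball 0 1 \<Longrightarrow> cmod (G z) \<le> B"
proof -
  have "cball 0 1 \<subseteq> ball (0::complex) R" using assms by auto
  hence "continuous_on (cball 0 1) G"
    using G holomorphic_on_imp_continuous_on holomorphic_on_subset by blast
  hence "bounded (G ` cball 0 1)"
    by (intro compact_imp_bounded compact_continuous_image) auto
  then obtain B where "\<forall>x\<in>G ` cball 0 1. cmod x \<le> B" unfolding bounded_iff by blast
  hence "cmod (G z) \<le> max B 0" if "z \<in> ball 0 1" for z
    using that by (simp add: le_max_iff_disj)
  thus ?thesis using that[of "max B 0"] by simp
qed

lemma holomorphic_beyond_imp_continuous:
  assumes "R > (1::real)" and "(G :: complex \<Rightarrow> complex) holomorphic_on ball 0 R"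
  shows "continuous_on (ball 0 1) G"
  using assms by (intro holomorphic_on_imp_continuous_on) (auto elim!: holomorphic_on_subset)

lemma integral_bergman_coefficient:
  assumes \<beta>: "\<beta> > 1" and a: "summable (\<lambda>n. cmod (a n))"
    and G: "\<And>z. z \<in> ball 0 1 \<Longrightarrow> (\<lambda>n. a n * z ^ n) sums G z"
  shows "(LINT z|bergman \<beta>. G z * cnj z ^ m) = a m * of_real (fact m / pochhammer \<beta> m)"
proof -
  have bound: "cmod (a n * z ^ n * cnj z ^ m) \<le> cmod (a n)" if "z \<in> ball 0 1" for n z
  proof -
    have "cmod (z ^ n * cnj z ^ m) \<le> 1"
      using that by (simp add: norm_mult norm_power mult_le_one power_le_one)
    thus ?thesis by (simp add: norm_mult mult.assoc mult_left_le)
  qed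
  have "(\<lambda>n. LINT z|bergman \<beta>. a n * z ^ n * cnj z ^ m) sums (LINT z|bergman \<beta>. G z * cnj z ^ m)"
    by (intro sums_integral_bergman[OF \<beta> _ bound a] continuous_intros sums_mult2 G)
  moreover have "(\<lambda>n. LINT z|bergman \<beta>. a n * z ^ n * cnj z ^ m)
      = (\<lambda>n. if n = m then a m * of_real (fact m / pochhammer \<beta> m) else 0)"
    using integral_bergman_monomials[OF \<beta>, of _ m] by (auto simp: mult.assoc fun_eq_iff)
  ultimately show ?thesis
    using sums_unique2[OF _ sums_single[of m "\<lambda>n. a m * of_real (fact m / pochhammer \<beta> m)"]]
    by simp
qed

text \<open>The power \<open>(1 - cnj w z)\<^bsup>-\<beta>\<^esup>\<close>, in the form \<open>exp (\<beta> u)\<close> in which its dependence on \<open>\<beta>\<close> can be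
  estimated and differentiated.\<close>

definition bergman_kernel :: "real \<Rightarrow> complex \<Rightarrow> complex \<Rightarrow> complex" where
  "bergman_kernel \<beta> w z = exp (- of_real \<beta> * Ln (1 - cnj w * z))"

lemma one_minus_in_right_half_plane:
  fixes w z :: complex
  assumes "cmod w * cmod z < 1"
  shows "Re (1 - cnj w * z) > 0" and "1 - cnj w * z \<notin> \<real>\<^sub>\<le>\<^sub>0" and "1 - cnj w * z \<noteq> 0"
proof -
  show pos: "Re (1 - cnj w * z) > 0"
    using assms complex_Re_le_cmod[of "cnj w * z"] by (simp add: norm_mult)
  thus "1 - cnj w * z \<notin> \<real>\<^sub>\<le>\<^sub>0"
    by (simp add: complex_nonpos_Reals_iff del: Re_complex_of_real minus_complex.simps times_complex.simps)
  show "1 - cnj w * z \<noteq> 0" using pos by (metis less_irrefl zero_complex.simps(1))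
qed

lemma bergman_kernel_powr:
  assumes "cmod w * cmod z < 1"
  shows "1 / (1 - cnj w * z) powr of_real \<beta> = bergman_kernel \<beta> w z"
  using one_minus_in_right_half_plane(3)[OF assms]
  by (simp add: bergman_kernel_def powr_def exp_minus divide_inverse)

lemma cnj_Ln_one_minus:
  assumes "cmod w * cmod z < 1"
  shows "cnj (Ln (1 - cnj w * z)) = Ln (1 - cnj z * w)"
  using cnj_Ln[OF one_minus_in_right_half_plane(2)[OF assms]] by (simp add: mult.commute)

lemma radius_beyond_disc:
  assumes "cmod w < 1"
  obtains R :: real where "R > 1" and "\<And>z. z \<in> ball 0 R \<Longrightarrow> cmod w * cmod z < 1"
proof (cases "w = 0")
  case True
  thus ?thesis using that[of 2] by simp
next
  case False
  thus ?thesis using that[of "1 / cmod w"] assms by (simp add: field_simps)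
qed

lemma Ln_one_minus_holomorphic:
  assumes "\<And>z. z \<in> A \<Longrightarrow> cmod w * cmod z < 1"
  shows "(\<lambda>z. Ln (1 - cnj w * z)) holomorphic_on A"
  by (intro holomorphic_intros one_minus_in_right_half_plane(2) assms)

lemma bergman_kernel_holomorphic:
  assumes "\<And>z. z \<in> A \<Longrightarrow> cmod w * cmod z < 1"
  shows "bergman_kernel \<beta> w holomorphic_on A"
  unfolding bergman_kernel_def
  by (intro holomorphic_intros one_minus_in_right_half_plane(2) assms)

text \<open>The binomial series.  Its coefficients \<open>(\<beta>)\<^sub>n / n!\<close> are the reciprocals of the moments of the
  Bergman measure.\<close>

lemma bergman_kernel_sums:
  assumes "cmod w * cmod z < 1"
  shows "(\<lambda>n. of_real (pochhammer \<beta> n / fact n) * cnj w ^ n * z ^ n) sums bergman_kernel \<beta> w z"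
proof -
  have "(\<lambda>n. (- of_real \<beta> gchoose n) * (- (cnj w * z)) ^ n) sums (1 + (- (cnj w * z))) powr (- of_real \<beta>)"
    by (rule gen_binomial_complex) (use assms in \<open>simp add: norm_mult\<close>)
  also have "(1 + (- (cnj w * z))) powr (- of_real \<beta>) = bergman_kernel \<beta> w z"
    using one_minus_in_right_half_plane(3)[OF assms] by (simp add: powr_def bergman_kernel_def)
  also have "(\<lambda>n. (- of_real \<beta> gchoose n) * (- (cnj w * z)) ^ n)
      = (\<lambda>n. of_real (pochhammer \<beta> n / fact n) * cnj w ^ n * z ^ n)"
  proof
    fix n
    have "(- (cnj w * z)) ^ n = (-1) ^ n * (cnj w ^ n * z ^ n)"
      by (metis mult_minus1 power_mult_distrib)
    moreover have "(-1 :: complex) ^ n * (-1) ^ n = 1"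
      by (simp flip: power_mult_distrib)
    ultimately show "(- of_real \<beta> gchoose n) * (- (cnj w * z)) ^ n
        = of_real (pochhammer \<beta> n / fact n) * cnj w ^ n * z ^ n"
      by (simp add: gbinomial_pochhammer pochhammer_of_real mult_ac)
  qed
  finally show ?thesis .
qed

text \<open>With \<open>G = \<Sum> a\<^sub>n z\<^sup>n\<close>, integrating against the \<open>n\<close>-th term of the conjugated kernel series yields
  \<open>a\<^sub>n \<cdot> n!/(\<beta>)\<^sub>n \<cdot> (\<beta>)\<^sub>n/n! \<cdot> w\<^sup>n = a\<^sub>n w\<^sup>n\<close>, and these sum to \<open>G(w)\<close>.\<close>

lemma bergman_reproducing:
  assumes \<beta>: "\<beta> > 1" and w: "w \<in> ball 0 1"
    and "R > 1" and G: "G holomorphic_on ball 0 R"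
  shows "(LINT z|bergman \<beta>. G z * cnj (bergman_kernel \<beta> w z)) = G w"
proof -
  obtain a where a: "summable (\<lambda>n. cmod (a n))"
    and Ga: "\<And>z. z \<in> ball 0 1 \<Longrightarrow> (\<lambda>n. a n * z ^ n) sums G z"
    using power_series_absolutely_summable[OF \<open>R > 1\<close> G] by blast
  obtain B where "B \<ge> 0" and B: "\<And>z. z \<in> ball 0 1 \<Longrightarrow> cmod (G z) \<le> B"
    using bounded_on_unit_disc[OF \<open>R > 1\<close> G] by blast
  define b where "b = (\<lambda>n. of_real (pochhammer \<beta> n / fact n) * w ^ n)"
  have b: "summable (\<lambda>n. cmod (b n))"
  proof -
    obtain r where r: "r > 1" "\<And>z. z \<in> ball 0 r \<Longrightarrow> cmod w * cmod z < 1"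
      using radius_beyond_disc[of w] w by auto
    obtain s where s: "1 < s" "s < r" using dense[OF r(1)] by auto
    have "summable (\<lambda>n. cnj (b n) * of_real s ^ n)"
      using sums_summable[OF bergman_kernel_sums[of w "of_real s" \<beta>]] s r(2)[of "of_real s"]
      by (simp add: b_def)
    from powser_insidea[OF this, of 1] s show ?thesis by simp
  qed
  have bound: "cmod (b n * (G z * cnj z ^ n)) \<le> cmod (b n) * B" if "z \<in> ball 0 1" for n z
  proof -
    have "cmod (G z * cnj z ^ n) \<le> B * 1"
      unfolding norm_mult using that B[OF that] \<open>B \<ge> 0\<close>
      by (intro mult_mono) (auto simp: norm_power power_le_one)
    thus ?thesis by (simp add: norm_mult mult_left_mono)
  qed
  have "(\<lambda>n. LINT z|bergman \<beta>. b n * (G z * cnj z ^ n))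
      sums (LINT z|bergman \<beta>. G z * cnj (bergman_kernel \<beta> w z))"
  proof (rule sums_integral_bergman[OF \<beta> _ bound])
    show "continuous_on (ball 0 1) (\<lambda>z. b n * (G z * cnj z ^ n))" for n
      using holomorphic_beyond_imp_continuous[OF \<open>R > 1\<close> G] by (intro continuous_intros)
    show "summable (\<lambda>n. cmod (b n) * B)" using b by (rule summable_mult2)
    fix z :: complex assume z: "z \<in> ball 0 1"
    have "cmod w * cmod z < 1"
      using w z mult_strict_mono'[of "cmod w" 1 "cmod z" 1] by simp
    hence "(\<lambda>n. cnj (b n) * z ^ n) sums bergman_kernel \<beta> w z"
      using bergman_kernel_sums[of w z \<beta>] by (simp add: b_def)
    hence "(\<lambda>n. G z * cnj (cnj (b n) * z ^ n)) sums (G z * cnj (bergman_kernel \<beta> w z))"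
      by (intro sums_mult) (simp only: sums_cnj)
    thus "(\<lambda>n. b n * (G z * cnj z ^ n)) sums (G z * cnj (bergman_kernel \<beta> w z))"
      by (simp add: mult_ac)
  qed
  moreover have "(LINT z|bergman \<beta>. b n * (G z * cnj z ^ n)) = a n * w ^ n" for n
  proof -
    have "pochhammer \<beta> n > 0" using \<beta> by (intro pochhammer_pos) auto
    thus ?thesis
      using integral_bergman_coefficient[OF \<beta> a Ga, of n] by (simp add: b_def)
  qed
  ultimately show ?thesis
    using sums_unique2 Ga[OF w] by simp
qed

section \<open>Holomorphic logarithms and perturbation estimates\<close>

text \<open>Mean value estimate; the constant depends on \<open>u\<close> only through the bound \<open>M\<close>, which gives
  uniformity over the disc.\<close>

lemma norm_exp_scaled_diff_le:
  fixes u :: complex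
  assumes u: "cmod u \<le> M" and t: "\<bar>t - s\<bar> \<le> 1"
  shows "cmod (exp (of_real t * u) - exp (of_real s * u)) \<le> M * exp ((\<bar>s\<bar> + 1) * M) * \<bar>t - s\<bar>"
proof -
  have M: "M \<ge> 0" using u norm_ge_zero[of u] by linarith
  have "cmod (exp (of_real t * u) - exp (of_real s * u))
      \<le> M * exp ((\<bar>s\<bar> + 1) * M) * cmod (of_real t - of_real s)"
  proof (rule field_differentiable_bound[where S = "cball (of_real s) 1"])
    fix z :: complex assume z: "z \<in> cball (of_real s) 1"
    show "((\<lambda>z. exp (z * u)) has_field_derivative u * exp (z * u)) (at z within cball (of_real s) 1)"
      by (auto intro!: derivative_eq_intros)
    have "cmod z \<le> \<bar>s\<bar> + 1"
      using z norm_triangle_ineq[of "of_real s" "z - of_real s"] by (simp add: dist_norm norm_minus_commute)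
    hence "cmod (z * u) \<le> (\<bar>s\<bar> + 1) * M"
      using u by (simp add: norm_mult mult_mono)
    hence "cmod (exp (z * u)) \<le> exp ((\<bar>s\<bar> + 1) * M)"
      using norm_exp[of "z * u"] by (meson exp_le_cancel_iff order_trans)
    thus "cmod (u * exp (z * u)) \<le> M * exp ((\<bar>s\<bar> + 1) * M)"
      using u M by (simp add: norm_mult mult_mono)
  qed (use t in \<open>auto simp: dist_norm abs_minus_commute simp flip: of_real_diff\<close>)
  thus ?thesis by (simp flip: of_real_diff)
qed

text \<open>This replaces differentiation under the integral sign: an error that is quadratic at \<open>a\<close> does not
  affect the derivative there.\<close>

lemma has_real_derivative_quadratic_perturbation:
  fixes P Q :: "real \<Rightarrow> real"
  assumes P: "(P has_real_derivative d) (at a)" and "\<delta> > 0"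
    and close: "\<And>x. \<bar>x - a\<bar> < \<delta> \<Longrightarrow> \<bar>Q x - P x\<bar> \<le> C * (x - a)\<^sup>2"
  shows "(Q has_real_derivative d) (at a)"
proof -
  define E where "E = (\<lambda>x. Q x - P x)"
  have "E a = 0" using close[of a] \<open>\<delta> > 0\<close> by (simp add: E_def)
  have "(E has_real_derivative 0) (at a)"
    unfolding has_field_derivative_iff
  proof (rule Lim_null_comparison)
    show "\<forall>\<^sub>F x in at a. norm ((E x - E a) / (x - a)) \<le> \<bar>C\<bar> * \<bar>x - a\<bar>"
      unfolding eventually_at
    proof (intro exI[of _ \<delta>] conjI ballI impI \<open>\<delta> > 0\<close>)
      fix x assume x: "x \<noteq> a \<and> dist x a < \<delta>"
      hence "\<bar>E x\<bar> \<le> C * (x - a)\<^sup>2" using close[of x] by (simp add: E_def dist_real_def)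
      also have "\<dots> \<le> \<bar>C\<bar> * \<bar>x - a\<bar> * \<bar>x - a\<bar>"
        by (simp add: power2_eq_square mult.assoc mult_right_mono flip: abs_mult)
      finally show "norm ((E x - E a) / (x - a)) \<le> \<bar>C\<bar> * \<bar>x - a\<bar>"
        using x \<open>E a = 0\<close> by (simp add: field_simps)
    qed
    show "((\<lambda>x. \<bar>C\<bar> * \<bar>x - a\<bar>) \<longlongrightarrow> 0) (at a)"
      by (auto intro!: tendsto_eq_intros)
  qed
  from DERIV_add[OF this P] show ?thesis by (simp add: E_def)
qed

text \<open>The exponential of \<open>u - v\<close> is constant, so \<open>u - v\<close> has derivative zero.\<close>

lemma holomorphic_logarithm_unique:
  assumes S: "convex S" "open S" and "u holomorphic_on S" "v holomorphic_on S"
    and eq: "\<And>z. z \<in> S \<Longrightarrow> exp (u z) = exp (v z)"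
  obtains n :: int where "\<And>z. z \<in> S \<Longrightarrow> u z = v z + 2 * of_int n * of_real pi * \<i>"
proof (cases "S = {}")
  case False
  then obtain z0 where z0: "z0 \<in> S" by blast
  have hol: "(\<lambda>z. u z - v z) holomorphic_on S" by (intro holomorphic_intros assms)
  have deriv0: "((\<lambda>z. u z - v z) has_field_derivative 0) (at z within S)" if z: "z \<in> S" for z
  proof -
    have d: "((\<lambda>z. u z - v z) has_field_derivative deriv (\<lambda>z. u z - v z) z) (at z)"
      using hol S(2) z by (rule holomorphic_derivI)
    have "((\<lambda>z. exp (u z - v z)) has_field_derivative exp (u z - v z) * deriv (\<lambda>z. u z - v z) z) (at z)"
      using d by (rule DERIV_exp[THEN DERIV_chain2])
    moreover have "((\<lambda>z. exp (u z - v z)) has_field_derivative 0) (at z)"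
    proof (rule has_field_derivative_transform_within_open[OF DERIV_const S(2) z])
      show "1 = exp (u z - v z)" if "z \<in> S" for z using eq[OF that] by (simp add: exp_diff)
    qed
    ultimately have "exp (u z - v z) * deriv (\<lambda>z. u z - v z) z = 0" by (rule DERIV_unique)
    thus ?thesis using d by (simp add: has_field_derivative_at_within)
  qed
  obtain c where c: "\<And>z. z \<in> S \<Longrightarrow> u z - v z = c"
    using has_field_derivative_zero_constant[OF S(1) deriv0] by blast
  obtain n :: int where "u z0 = v z0 + 2 * of_int n * of_real pi * \<i>"
    using eq[OF z0] by (auto simp: exp_eq)
  hence "u z = v z + 2 * of_int n * of_real pi * \<i>" if "z \<in> S" for z
    using c[OF that] c[OF z0] by (simp add: algebra_simps)
  thus ?thesis by (rule that)
qed (use that in auto)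

text \<open>A function in \<open>Ostar\<close> is nonzero on a disc of radius \<open>1 + e\<close>, hence has a logarithm there; adding
  a multiple of \<open>2\<pi>\<i>\<close> makes it agree with \<open>h\<close>.\<close>

lemma Ostar_logarithm_extends:
  assumes f: "f \<in> Ostar" and h: "h holomorphic_on ball 0 1" "\<And>z. z \<in> ball 0 1 \<Longrightarrow> f z = exp (h z)"
  obtains H R where "R > 1" "H holomorphic_on ball 0 R" "\<And>z. z \<in> ball 0 1 \<Longrightarrow> H z = h z"
proof -
  obtain U where U: "open U" "cball 0 1 \<subseteq> U" "f holomorphic_on U"
    and nz: "\<And>z. z \<in> cball 0 1 \<Longrightarrow> f z \<noteq> 0"
    using f by (auto simp: Ostar_def)
  define V where "V = U \<inter> f -` (- {0})"
  have "open V" unfolding V_def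
    using U by (intro continuous_open_preimage holomorphic_on_imp_continuous_on) auto
  moreover have "cball 0 1 \<subseteq> V" using U nz by (auto simp: V_def)
  ultimately obtain e where e: "e > 0" "(\<Union>x\<in>cball 0 1. ball x e) \<subseteq> V"
    using compact_subset_open_imp_ball_epsilon_subset[of "cball (0::complex) 1" V] by auto
  have RV: "ball 0 (1 + e) \<subseteq> V"
  proof
    fix z :: complex assume z: "z \<in> ball 0 (1 + e)"
    \<comment> \<open>The point of the closed unit disc nearest to \<open>z\<close>.\<close>
    define x where "x = (if cmod z \<le> 1 then z else z /\<^sub>R cmod z)"
    have "x \<in> cball 0 1" by (auto simp: x_def field_simps)
    moreover have "dist x z < e"
    proof (cases "cmod z \<le> 1")
      case False
      have "x - z = (1 / cmod z - 1) *\<^sub>R z" using False by (simp add: x_def scaleR_diff_left divide_inverse)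
      hence "dist x z = \<bar>1 / cmod z - 1\<bar> * cmod z" by (simp add: dist_norm)
      also have "\<dots> = cmod z - 1" using False by (auto simp: abs_if field_simps)
      finally show ?thesis using z by simp
    qed (use e in \<open>simp add: x_def\<close>)
    ultimately show "z \<in> V" using e(2) by (meson UN_I mem_ball subsetD)
  qed
  obtain H0 where H0: "H0 holomorphic_on ball 0 (1 + e)" "\<And>z. z \<in> ball 0 (1 + e) \<Longrightarrow> exp (H0 z) = f z"
    using RV U e
    by (elim holomorphic_logarithm_exists[of "ball 0 (1 + e)" f 0, rotated 5])
       (auto simp: V_def elim!: holomorphic_on_subset)
  have sub: "ball 0 1 \<subseteq> ball (0::complex) (1 + e)" using e by auto
  obtain n :: int where n: "\<And>z. z \<in> ball 0 1 \<Longrightarrow> h z = H0 z + 2 * of_int n * of_real pi * \<i>"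
  proof (rule holomorphic_logarithm_unique)
    show "exp (h z) = exp (H0 z)" if "z \<in> ball 0 1" for z
      using h(2)[OF that] H0(2)[of z] sub that by auto
  qed (use h H0 sub holomorphic_on_subset in auto)
  show ?thesis
    by (rule that[of "1 + e" "\<lambda>z. H0 z + 2 * of_int n * of_real pi * \<i>"])
       (use n e H0 in \<open>auto intro!: holomorphic_intros\<close>)
qed

section \<open>Second-order expansion of the Bergman norm\<close>

lemma integral_bergman_cnj_kernel_sum:
  assumes \<beta>: "\<beta> > 1" and w: "w ` I \<subseteq> ball 0 1"
    and "R > 1" and F: "F holomorphic_on ball 0 R"
  shows "(LINT z|bergman \<beta>. F z * cnj (\<Sum>i\<in>I. c i * bergman_kernel \<beta> (w i) z)) = (\<Sum>i\<in>I. cnj (c i) * F (w i))"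
proof -
  have wi: "w i \<in> ball 0 1" if "i \<in> I" for i using w that by auto
  have int: "integrable (bergman \<beta>) (\<lambda>z. F z * cnj (bergman_kernel \<beta> (w i) z))" if i: "i \<in> I" for i
  proof -
    obtain r where r: "r > 1" "\<And>z. z \<in> ball 0 r \<Longrightarrow> cmod (w i) * cmod z < 1"
      using radius_beyond_disc[of "w i"] wi[OF i] by auto
    note K = bergman_kernel_holomorphic[of "ball 0 r" "w i" \<beta>, OF r(2)]
    obtain A where A: "\<And>z. z \<in> ball 0 1 \<Longrightarrow> cmod (bergman_kernel \<beta> (w i) z) \<le> A"
      using bounded_on_unit_disc[OF r(1) K] by blast
    obtain B where B: "B \<ge> 0" "\<And>z. z \<in> ball 0 1 \<Longrightarrow> cmod (F z) \<le> B"
      using bounded_on_unit_disc[OF \<open>R > 1\<close> F] by blast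
    show ?thesis
    proof (rule integrable_bergman_bounded[OF \<beta>])
      show "continuous_on (ball 0 1) (\<lambda>z. F z * cnj (bergman_kernel \<beta> (w i) z))"
        by (intro continuous_intros holomorphic_beyond_imp_continuous[OF \<open>R > 1\<close> F]
              holomorphic_beyond_imp_continuous[OF r(1) K])
      show "cmod (F z * cnj (bergman_kernel \<beta> (w i) z)) \<le> B * A" if "z \<in> ball 0 1" for z
        using A[OF that] B(1) B(2)[OF that] by (simp add: norm_mult mult_mono)
    qed
  qed
  have "(LINT z|bergman \<beta>. F z * cnj (\<Sum>i\<in>I. c i * bergman_kernel \<beta> (w i) z))
      = (LINT z|bergman \<beta>. (\<Sum>i\<in>I. cnj (c i) * (F z * cnj (bergman_kernel \<beta> (w i) z))))"
    by (simp add: sum_distrib_left mult_ac)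
  also have "\<dots> = (\<Sum>i\<in>I. (LINT z|bergman \<beta>. cnj (c i) * (F z * cnj (bergman_kernel \<beta> (w i) z))))"
    by (rule Bochner_Integration.integral_sum) (intro integrable_mult_right int)
  also have "\<dots> = (\<Sum>i\<in>I. cnj (c i) * F (w i))"
    by (intro sum.cong refl) (simp add: bergman_reproducing[OF \<beta> wi \<open>R > 1\<close> F])
  finally show ?thesis .
qed

text \<open>A disc larger than the unit disc on which all the functions \<open>1 - cnj (w i) * z\<close> keep a positive
  real part, so that all the kernels are holomorphic there.\<close>

lemma common_radius_beyond_disc:
  assumes "finite I" and w: "w ` I \<subseteq> ball 0 1"
  obtains R :: real where "R > 1" and "\<And>i z. i \<in> I \<Longrightarrow> z \<in> ball 0 R \<Longrightarrow> cmod (w i) * cmod z < 1"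
proof -
  define m where "m = Max (insert 0 ((\<lambda>i. cmod (w i)) ` I))"
  have m_ge: "cmod (w i) \<le> m" if "i \<in> I" for i
    unfolding m_def using that \<open>finite I\<close> by (intro Max_ge) auto
  have m: "0 \<le> m" "m < 1"
    unfolding m_def using w \<open>finite I\<close> by (auto intro!: Max_ge)
  obtain R where R: "R > 1" "\<And>z. z \<in> ball 0 R \<Longrightarrow> cmod (of_real m) * cmod z < 1"
    using radius_beyond_disc[of "of_real m"] m by auto
  have "cmod (w i) * cmod z < 1" if "i \<in> I" "z \<in> ball 0 R" for i z
    using R(2)[OF that(2)] m_ge[OF that(1)] m by (auto intro: le_less_trans[OF mult_right_mono])
  thus ?thesis using R(1) that by blast
qed

lemma kernel_sum_holomorphic:
  assumes "\<And>i z. i \<in> I \<Longrightarrow> z \<in> A \<Longrightarrow> cmod (w i) * cmod z < 1"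
  shows "(\<lambda>z. \<Sum>i\<in>I. c i * bergman_kernel \<beta> (w i) z) holomorphic_on A"
  by (intro holomorphic_on_sum holomorphic_on_mult holomorphic_on_const
        bergman_kernel_holomorphic assms)

text \<open>Expand \<open>|F|\<^sup>2 = 2 Re (F cnj G) - |G|\<^sup>2 + |F - G|\<^sup>2\<close> for \<open>G\<close> the kernel sum.  The reproducing property
  evaluates the first two integrals, the second one by applying it with \<open>G\<close> in the place of \<open>F\<close>.\<close>

lemma integral_norm_squared_expand:
  fixes c :: "'i \<Rightarrow> complex"
  assumes \<beta>: "\<beta> > 1" and "finite I" and w: "w ` I \<subseteq> ball 0 1"
    and "R > 1" and F: "F holomorphic_on ball 0 R"
  shows "(LINT z|bergman \<beta>. (cmod (F z))\<^sup>2) =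
      Re (2 * (\<Sum>j\<in>I. cnj (c j) * F (w j))
          - (\<Sum>i\<in>I. \<Sum>j\<in>I. c i * cnj (c j) * bergman_kernel \<beta> (w i) (w j)))
      + (LINT z|bergman \<beta>. (cmod (F z - (\<Sum>i\<in>I. c i * bergman_kernel \<beta> (w i) z)))\<^sup>2)"
proof -
  define G where "G = (\<lambda>z. \<Sum>i\<in>I. c i * bergman_kernel \<beta> (w i) z)"
  obtain r where r: "r > 1" "\<And>i z. i \<in> I \<Longrightarrow> z \<in> ball 0 r \<Longrightarrow> cmod (w i) * cmod z < 1"
    using common_radius_beyond_disc[OF \<open>finite I\<close> w] by blast
  have G: "G holomorphic_on ball 0 r" unfolding G_def by (rule kernel_sum_holomorphic[OF r(2)])
  obtain A where A: "\<And>z. z \<in> ball 0 1 \<Longrightarrow> cmod (G z) \<le> A"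
    using bounded_on_unit_disc[OF r(1) G] by blast
  obtain B where B: "B \<ge> 0" "\<And>z. z \<in> ball 0 1 \<Longrightarrow> cmod (F z) \<le> B"
    using bounded_on_unit_disc[OF \<open>R > 1\<close> F] by blast
  have Fc: "continuous_on (ball 0 1) F" and Gc: "continuous_on (ball 0 1) G"
    using holomorphic_beyond_imp_continuous \<open>R > 1\<close> F r(1) G by blast+
  have int1: "integrable (bergman \<beta>) (\<lambda>z. F z * cnj (G z))"
  proof (rule integrable_bergman_bounded[OF \<beta>])
    show "cmod (F z * cnj (G z)) \<le> B * A" if "z \<in> ball 0 1" for z
      using A[OF that] B(1) B(2)[OF that] by (simp add: norm_mult mult_mono)
  qed (intro continuous_intros Fc Gc)
  have int2: "integrable (bergman \<beta>) (\<lambda>z. G z * cnj (G z))"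
  proof (rule integrable_bergman_bounded[OF \<beta>])
    show "cmod (G z * cnj (G z)) \<le> A * A" if "z \<in> ball 0 1" for z
      using A[OF that] norm_ge_zero[of "G z"] by (simp add: norm_mult mult_mono del: norm_ge_zero)
  qed (intro continuous_intros Gc)
  have int3: "integrable (bergman \<beta>) (\<lambda>z. (cmod (F z - G z))\<^sup>2)"
  proof (rule integrable_bergman_bounded[OF \<beta>])
    show "norm ((cmod (F z - G z))\<^sup>2) \<le> (B + A)\<^sup>2" if "z \<in> ball 0 1" for z
      using norm_triangle_ineq4[of "F z" "G z"] A[OF that] B(2)[OF that] by (simp add: power_mono)
  qed (intro continuous_intros Fc Gc)
  have pointwise: "(cmod x)\<^sup>2 = Re (2 * (x * cnj y) - y * cnj y) + (cmod (x - y))\<^sup>2" for x y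
    unfolding cmod_power2 by (simp add: power2_eq_square algebra_simps)
  have "(LINT z|bergman \<beta>. (cmod (F z))\<^sup>2)
      = (LINT z|bergman \<beta>. (Re (2 * (F z * cnj (G z)) - G z * cnj (G z)) + (cmod (F z - G z))\<^sup>2))"
    by (intro Bochner_Integration.integral_cong refl pointwise)
  also have "\<dots> = Re (LINT z|bergman \<beta>. 2 * (F z * cnj (G z)) - G z * cnj (G z))
      + (LINT z|bergman \<beta>. (cmod (F z - G z))\<^sup>2)"
    using int1 int2 int3
    by (subst Bochner_Integration.integral_add; (subst integral_Re)?)
       (auto intro!: integrable_Re Bochner_Integration.integrable_diff integrable_mult_right
         simp del: minus_complex.simps times_complex.simps)
  also have "(LINT z|bergman \<beta>. 2 * (F z * cnj (G z)) - G z * cnj (G z))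
      = 2 * (LINT z|bergman \<beta>. F z * cnj (G z)) - (LINT z|bergman \<beta>. G z * cnj (G z))"
    using int1 int2 by (subst Bochner_Integration.integral_diff) auto
  also have "(LINT z|bergman \<beta>. F z * cnj (G z)) = (\<Sum>j\<in>I. cnj (c j) * F (w j))"
    unfolding G_def by (rule integral_bergman_cnj_kernel_sum[OF \<beta> w \<open>R > 1\<close> F])
  also have "(LINT z|bergman \<beta>. G z * cnj (G z)) = (\<Sum>j\<in>I. cnj (c j) * G (w j))"
    using integral_bergman_cnj_kernel_sum[OF \<beta> w r(1) G, where c = c] by (simp add: G_def)
  also have "\<dots> = (\<Sum>i\<in>I. \<Sum>j\<in>I. c i * cnj (c j) * bergman_kernel \<beta> (w i) (w j))"
    unfolding G_def by (subst sum.swap) (simp add: sum_distrib_left mult_ac)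
  finally show ?thesis by (simp only: G_def)
qed

text \<open>The two functions coincide at \<open>\<beta> = \<alpha>\<close>, and \<open>e\<^bsup>\<beta>h\<^esup>\<close> as well as each kernel has the form \<open>exp (\<beta> u)\<close> with
  \<open>u\<close> bounded on the disc.  Squared, the bound makes the error term in the expansion of the norm
  quadratic in \<open>\<beta> - \<alpha>\<close>.\<close>

lemma kernel_sum_distance_quadratic:
  fixes c :: "'i \<Rightarrow> complex"
  assumes "finite I" and w: "w ` I \<subseteq> ball 0 1"
    and "R > 1" and H: "H holomorphic_on ball 0 R"
    and eq: "\<And>z. z \<in> ball 0 1 \<Longrightarrow> exp (of_real \<alpha> * H z) = (\<Sum>i\<in>I. c i * bergman_kernel \<alpha> (w i) z)"
  obtains C where "\<And>\<beta> z. \<bar>\<beta> - \<alpha>\<bar> \<le> 1 \<Longrightarrow> z \<in> ball 0 1 \<Longrightarrow>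
    cmod (exp (of_real \<beta> * H z) - (\<Sum>i\<in>I. c i * bergman_kernel \<beta> (w i) z)) \<le> C * \<bar>\<beta> - \<alpha>\<bar>"
proof -
  obtain r where r: "r > 1" "\<And>i z. i \<in> I \<Longrightarrow> z \<in> ball 0 r \<Longrightarrow> cmod (w i) * cmod z < 1"
    using common_radius_beyond_disc[OF \<open>finite I\<close> w] by blast
  have "\<forall>i\<in>I. \<exists>M. \<forall>z\<in>ball 0 1. cmod (Ln (1 - cnj (w i) * z)) \<le> M"
  proof
    fix i assume "i \<in> I"
    hence "(\<lambda>z. Ln (1 - cnj (w i) * z)) holomorphic_on ball 0 r"
      using r(2) by (intro Ln_one_minus_holomorphic)
    from r(1) this show "\<exists>M. \<forall>z\<in>ball 0 1. cmod (Ln (1 - cnj (w i) * z)) \<le> M"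
      by (rule bounded_on_unit_disc) blast
  qed
  from bchoice[OF this] obtain M where M: "\<And>i z. i \<in> I \<Longrightarrow> z \<in> ball 0 1 \<Longrightarrow> cmod (Ln (1 - cnj (w i) * z)) \<le> M i"
    by blast
  obtain B where B: "\<And>z. z \<in> ball 0 1 \<Longrightarrow> cmod (H z) \<le> B"
    using bounded_on_unit_disc[OF \<open>R > 1\<close> H] by blast
  define X where "X = (\<lambda>m. m * exp ((\<bar>\<alpha>\<bar> + 1) * m))"
  show ?thesis
  proof (rule that[of "X B + (\<Sum>i\<in>I. cmod (c i) * X (M i))"])
    fix \<beta> z assume \<beta>: "\<bar>\<beta> - \<alpha>\<bar> \<le> 1" and z: "z \<in> ball (0::complex) 1"
    have K: "cmod (c i * (bergman_kernel \<beta> (w i) z - bergman_kernel \<alpha> (w i) z))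
        \<le> cmod (c i) * X (M i) * \<bar>\<beta> - \<alpha>\<bar>" if "i \<in> I" for i
      unfolding norm_mult mult.assoc X_def
      using norm_exp_scaled_diff_le[of "- Ln (1 - cnj (w i) * z)" "M i" \<beta> \<alpha>, OF _ \<beta>] M[OF that z]
      by (intro mult_left_mono) (auto simp: bergman_kernel_def mult_ac)
    have "exp (of_real \<beta> * H z) - (\<Sum>i\<in>I. c i * bergman_kernel \<beta> (w i) z)
        = (exp (of_real \<beta> * H z) - exp (of_real \<alpha> * H z))
          - (\<Sum>i\<in>I. c i * (bergman_kernel \<beta> (w i) z - bergman_kernel \<alpha> (w i) z))"
      by (simp add: eq[OF z] right_diff_distrib sum_subtractf)
    also have "cmod \<dots> \<le> X B * \<bar>\<beta> - \<alpha>\<bar> + (\<Sum>i\<in>I. cmod (c i) * X (M i) * \<bar>\<beta> - \<alpha>\<bar>)"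
      using norm_exp_scaled_diff_le[OF B[OF z] \<beta>]
      by (intro order_trans[OF norm_triangle_ineq4 add_mono] sum_norm_le K) (simp_all add: X_def)
    finally show "cmod (exp (of_real \<beta> * H z) - (\<Sum>i\<in>I. c i * bergman_kernel \<beta> (w i) z))
        \<le> (X B + (\<Sum>i\<in>I. cmod (c i) * X (M i))) * \<bar>\<beta> - \<alpha>\<bar>"
      by (simp add: distrib_right sum_distrib_right)
  qed
qed

text \<open>Near \<open>\<alpha>\<close> the integral \<open>Q\<close> differs from the real part of the finite sum \<open>S\<close> by \<open>O((\<beta> - \<alpha>)\<^sup>2)\<close>.  The
  derivative \<open>S'\<close> weights the Gram matrix \<open>e\<close> by \<open>2 H(w\<^sub>j) + L\<^sub>i\<^sub>j\<close>; since \<open>e\<close> and \<open>L\<close> are Hermitian,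
  taking the real part symmetrises \<open>2 H(w\<^sub>j)\<close> into \<open>cnj (H(w\<^sub>i)) + H(w\<^sub>j)\<close>.\<close>

lemma bergman_integral_derivative:
  fixes c :: "'i \<Rightarrow> complex"
  assumes \<alpha>: "\<alpha> > 1" and "finite I" and w: "w ` I \<subseteq> ball 0 1"
    and "R > 1" and H: "H holomorphic_on ball 0 R"
    and eq: "\<And>z. z \<in> ball 0 1 \<Longrightarrow> exp (of_real \<alpha> * H z) = (\<Sum>i\<in>I. c i * bergman_kernel \<alpha> (w i) z)"
  defines "Q \<equiv> \<lambda>\<beta>. LINT z|bergman \<beta>. (cmod (exp (of_real \<beta> * H z)))\<^sup>2"
  defines "e \<equiv> \<lambda>i j. c i * cnj (c j) * bergman_kernel \<alpha> (w i) (w j)"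
  obtains d where "(Q has_real_derivative d) (at \<alpha>)"
    and "of_real d = (\<Sum>i\<in>I. \<Sum>j\<in>I. e i j * (cnj (H (w i)) + H (w j) + Ln (1 - cnj (w i) * w j)))"
    and "of_real (Q \<alpha>) = (\<Sum>i\<in>I. \<Sum>j\<in>I. e i j)"
proof -
  define L where "L = (\<lambda>i j. Ln (1 - cnj (w i) * w j))"
  define S where "S = (\<lambda>b. 2 * (\<Sum>j\<in>I. cnj (c j) * exp (b * H (w j)))
      - (\<Sum>i\<in>I. \<Sum>j\<in>I. c i * cnj (c j) * exp (- b * L i j)))"
  define S' where "S' = (\<Sum>i\<in>I. \<Sum>j\<in>I. e i j * (2 * H (w j) + L i j))"
  define Gm where "Gm = (\<lambda>\<beta> z. \<Sum>i\<in>I. c i * bergman_kernel \<beta> (w i) z)"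
  have wi: "w i \<in> ball 0 1" if "i \<in> I" for i using w that by auto
  have mod: "cmod (w i) * cmod (w j) < 1" if "i \<in> I" "j \<in> I" for i j
    using wi[OF that(1)] wi[OF that(2)] mult_strict_mono'[of "cmod (w i)" 1 "cmod (w j)" 1] by simp
  have L_herm: "cnj (L i j) = L j i" if "i \<in> I" "j \<in> I" for i j
    using cnj_Ln_one_minus[OF mod[OF that]] by (simp add: L_def)
  have e_herm: "cnj (e i j) = e j i" if "i \<in> I" "j \<in> I" for i j
    using L_herm[OF that] by (simp add: e_def bergman_kernel_def L_def exp_cnj mult_ac)
  have e_L: "e i j = c i * cnj (c j) * exp (- of_real \<alpha> * L i j)" for i j
    by (simp add: e_def bergman_kernel_def L_def)
  \<comment> \<open>The hypothesis at the points \<open>w\<^sub>j\<close> makes the first sum of \<open>S\<close> a sum over columns of the Gram matrix.\<close>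
  have column: "cnj (c j) * exp (of_real \<alpha> * H (w j)) = (\<Sum>i\<in>I. e i j)" if "j \<in> I" for j
    by (simp add: eq[OF wi[OF that]] e_def sum_distrib_left mult_ac)
  have expand: "Q \<beta> = Re (S (of_real \<beta>))
      + (LINT z|bergman \<beta>. (cmod (exp (of_real \<beta> * H z) - Gm \<beta> z))\<^sup>2)" if "\<beta> > 1" for \<beta>
    unfolding Q_def S_def Gm_def
    by (subst integral_norm_squared_expand[OF that \<open>finite I\<close> w \<open>R > 1\<close>, where c = c])
       (auto intro!: holomorphic_intros H simp: bergman_kernel_def L_def)

  have "(S has_field_derivative S') (at (of_real \<alpha>))"
  proof -
    have "(S has_field_derivative (2 * (\<Sum>j\<in>I. cnj (c j) * exp (of_real \<alpha> * H (w j)) * H (w j))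
        + (\<Sum>i\<in>I. \<Sum>j\<in>I. e i j * L i j))) (at (of_real \<alpha>))"
      unfolding S_def e_L
      by (auto intro!: derivative_eq_intros sum.cong simp: sum_negf mult_ac simp flip: sum_negf)
    also have "(\<Sum>j\<in>I. cnj (c j) * exp (of_real \<alpha> * H (w j)) * H (w j)) = (\<Sum>i\<in>I. \<Sum>j\<in>I. e i j * H (w j))"
      by (subst sum.swap) (simp add: column sum_distrib_right)
    finally show ?thesis
      by (simp add: S'_def sum_distrib_left sum.distrib distrib_left mult_ac)
  qed
  hence P: "((\<lambda>\<beta>. Re (S (of_real \<beta>))) has_real_derivative Re S') (at \<alpha>)"
    by (intro has_field_derivative_Re has_vector_derivative_real_field)

  obtain C where C: "\<And>\<beta> z. \<bar>\<beta> - \<alpha>\<bar> \<le> 1 \<Longrightarrow> z \<in> ball 0 1 \<Longrightarrow>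
      cmod (exp (of_real \<beta> * H z) - Gm \<beta> z) \<le> C * \<bar>\<beta> - \<alpha>\<bar>"
    using kernel_sum_distance_quadratic[OF \<open>finite I\<close> w \<open>R > 1\<close> H eq] unfolding Gm_def by blast
  have close: "\<bar>Q \<beta> - Re (S (of_real \<beta>))\<bar> \<le> C\<^sup>2 * (\<beta> - \<alpha>)\<^sup>2" if "\<bar>\<beta> - \<alpha>\<bar> < min 1 (\<alpha> - 1)" for \<beta>
  proof -
    have \<beta>: "\<beta> > 1" "\<bar>\<beta> - \<alpha>\<bar> \<le> 1" using that by auto
    have "Gm \<beta> holomorphic_on ball 0 1"
      unfolding Gm_def
    proof (rule kernel_sum_holomorphic)
      show "cmod (w i) * cmod z < 1" if "i \<in> I" "z \<in> ball 0 1" for i z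
        using wi[OF that(1)] that(2) mult_strict_mono'[of "cmod (w i)" 1 "cmod z" 1] by simp
    qed
    hence cont: "continuous_on (ball 0 1) (\<lambda>z. (cmod (exp (of_real \<beta> * H z) - Gm \<beta> z))\<^sup>2)"
      by (intro continuous_intros holomorphic_beyond_imp_continuous[OF \<open>R > 1\<close> H]
            holomorphic_on_imp_continuous_on)
    have up: "(cmod (exp (of_real \<beta> * H z) - Gm \<beta> z))\<^sup>2 \<le> C\<^sup>2 * (\<beta> - \<alpha>)\<^sup>2" if "z \<in> ball 0 1" for z
      using power_mono[OF C[OF \<beta>(2) that], of 2] by (simp add: power_mult_distrib)
    show ?thesis
      using integral_bergman_bounds[OF \<beta>(1) cont, of 0 "C\<^sup>2 * (\<beta> - \<alpha>)\<^sup>2"] up expand[OF \<beta>(1)]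
      by simp
  qed
  have der: "(Q has_real_derivative Re S') (at \<alpha>)"
    using \<alpha> by (intro has_real_derivative_quadratic_perturbation[OF P _ close, where \<delta> = "min 1 (\<alpha> - 1)"]) auto

  have cnj_sum: "cnj (\<Sum>i\<in>I. \<Sum>j\<in>I. e i j * t i j) = (\<Sum>i\<in>I. \<Sum>j\<in>I. e i j * cnj (t j i))" for t
    by (subst sum.swap) (simp add: e_herm)
  have "of_real (2 * Re S') = S' + cnj S'"
    by (simp add: complex_add_cnj)
  also have "cnj S' = (\<Sum>i\<in>I. \<Sum>j\<in>I. e i j * (2 * cnj (H (w i)) + L i j))"
    unfolding S'_def cnj_sum by (simp add: L_herm)
  also have "S' + \<dots> = 2 * (\<Sum>i\<in>I. \<Sum>j\<in>I. e i j * (cnj (H (w i)) + H (w j) + L i j))"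
    unfolding S'_def by (simp add: sum_distrib_left sum.distrib[symmetric] algebra_simps)
  finally have val: "of_real (Re S') = (\<Sum>i\<in>I. \<Sum>j\<in>I. e i j * (cnj (H (w i)) + H (w j) + L i j))"
    by simp

  have "Q \<alpha> = Re (S (of_real \<alpha>))" using close[of \<alpha>] \<alpha> by simp
  also have "S (of_real \<alpha>) = 2 * (\<Sum>j\<in>I. \<Sum>i\<in>I. e i j) - (\<Sum>i\<in>I. \<Sum>j\<in>I. e i j)"
    by (simp add: S_def column e_L)
  also have "(\<Sum>j\<in>I. \<Sum>i\<in>I. e i j) = (\<Sum>i\<in>I. \<Sum>j\<in>I. e i j)" by (rule sum.swap)
  finally have Q: "Q \<alpha> = Re (\<Sum>i\<in>I. \<Sum>j\<in>I. e i j)" by simp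
  have "cnj (\<Sum>i\<in>I. \<Sum>j\<in>I. e i j) = (\<Sum>i\<in>I. \<Sum>j\<in>I. e i j)"
    using cnj_sum[of "\<lambda>_ _. 1"] by simp
  hence "(\<Sum>i\<in>I. \<Sum>j\<in>I. e i j) \<in> \<real>" by (simp add: Reals_cnj_iff)
  hence "of_real (Q \<alpha>) = (\<Sum>i\<in>I. \<Sum>j\<in>I. e i j)" by (simp only: Q of_real_Re)
  with der val show ?thesis unfolding L_def by (rule that)
qed

section \<open>The derivative of the norm\<close>

lemma N_eq_bergman_integral:
  assumes "\<beta> > 1" and h: "continuous_on (ball 0 1) h" and f: "\<And>z. z \<in> ball 0 1 \<Longrightarrow> f z = exp (h z)"
  shows "N f \<beta> = (LINT z|bergman \<beta>. (cmod (exp (of_real \<beta> * h z)))\<^sup>2) powr (1 / (2 * \<beta>))"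
proof -
  have "(LINT z|bergman \<beta>. (cmod (exp (of_real \<beta> * h z)))\<^sup>2)
      = (LINT z:ball 0 1|lborel.
          cmod (f z) powr (2 * \<beta>) * (\<beta> - 1) * (1 - (cmod z)\<^sup>2) powr (\<beta> - 2) / pi)"
  proof (subst integral_bergman_eq)
    show "continuous_on (ball 0 1) (\<lambda>z. (cmod (exp (of_real \<beta> * h z)))\<^sup>2)"
      by (intro continuous_intros h)
    have "(cmod (exp (of_real \<beta> * h z)))\<^sup>2 = cmod (f z) powr (2 * \<beta>)" if "z \<in> ball 0 1" for z
      by (simp add: f[OF that] powr_def power2_eq_square flip: exp_add)
    thus "(LINT z|lborel. indicator (ball 0 1) z *\<^sub>R
            (bergman_weight \<beta> ((cmod z)\<^sup>2) *\<^sub>R (cmod (exp (of_real \<beta> * h z)))\<^sup>2))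
        = (LINT z:ball 0 1|lborel.
          cmod (f z) powr (2 * \<beta>) * (\<beta> - 1) * (1 - (cmod z)\<^sup>2) powr (\<beta> - 2) / pi)"
      unfolding set_lebesgue_integral_def
      by (intro Bochner_Integration.integral_cong) (auto simp: indicator_def bergman_weight_def)
  qed fact
  thus ?thesis by (simp add: N_def)
qed

lemma bergman_integral_pos:
  assumes "\<beta> > 1" and "R > 1" and H: "H holomorphic_on ball 0 R"
  shows "(LINT z|bergman \<beta>. (cmod (exp (of_real \<beta> * H z)))\<^sup>2) > 0"
proof -
  obtain B where B: "\<And>z. z \<in> ball 0 1 \<Longrightarrow> cmod (H z) \<le> B"
    using bounded_on_unit_disc[OF \<open>R > 1\<close> H] by blast
  have cont: "continuous_on (ball 0 1) (\<lambda>z. (cmod (exp (of_real \<beta> * H z)))\<^sup>2)"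
    by (intro continuous_intros holomorphic_beyond_imp_continuous[OF \<open>R > 1\<close> H])
  have Re_bound: "\<bar>Re (H z)\<bar> \<le> B" if "z \<in> ball 0 1" for z
    using abs_Re_le_cmod[of "H z"] B[OF that] by linarith
  have "(exp (- \<beta> * B))\<^sup>2 \<le> (LINT z|bergman \<beta>. (cmod (exp (of_real \<beta> * H z)))\<^sup>2)"
  proof (rule integral_bergman_bounds(1)[OF \<open>\<beta> > 1\<close> cont])
    fix z :: complex assume z: "z \<in> ball 0 1"
    have "\<beta> * (- B) \<le> \<beta> * Re (H z)" "\<beta> * Re (H z) \<le> \<beta> * B"
      using Re_bound[OF z] \<open>\<beta> > 1\<close> by (intro mult_left_mono; linarith)+
    thus "(exp (- \<beta> * B))\<^sup>2 \<le> (cmod (exp (of_real \<beta> * H z)))\<^sup>2"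
      and "(cmod (exp (of_real \<beta> * H z)))\<^sup>2 \<le> (exp (\<beta> * B))\<^sup>2"
      by (auto intro!: power_mono)
  qed
  moreover have "(exp (- \<beta> * B))\<^sup>2 > 0" by simp
  ultimately show ?thesis by linarith
qed

text \<open>For \<open>Q\<close> the integral above, \<open>n\<close> is the norm \<open>N f \<alpha>\<close>, in which the derivative is to be expressed.\<close>

lemma root_derivative:
  fixes Q :: "real \<Rightarrow> real"
  assumes Q: "(Q has_real_derivative d) (at \<alpha>)" and pos: "Q \<alpha> > 0" and "\<alpha> > 0"
  defines "n \<equiv> Q \<alpha> powr (1 / (2 * \<alpha>))"
  shows "((\<lambda>\<beta>. Q \<beta> powr (1 / (2 * \<beta>))) has_real_derivative
    1 / (2 * \<alpha>\<^sup>2) * n powr (1 - 2 * \<alpha>) * (\<alpha> * d - 2 * \<alpha> * ln n * Q \<alpha>)) (at \<alpha>)"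
proof -
  have "((\<lambda>\<beta>. Q \<beta> powr (1 / (2 * \<beta>))) has_real_derivative
      n * (- (1 / (2 * \<alpha>\<^sup>2)) * ln (Q \<alpha>) + d * (1 / (2 * \<alpha>)) / Q \<alpha>)) (at \<alpha>)"
    unfolding n_def
    by (rule DERIV_powr[OF Q pos, THEN DERIV_cong])
       (use \<open>\<alpha> > 0\<close> in \<open>auto intro!: derivative_eq_intros simp: power2_eq_square field_simps\<close>)
  moreover have "n powr (1 - 2 * \<alpha>) = n / Q \<alpha>"
  proof -
    have "n > 0" using pos by (simp add: n_def)
    moreover have "n powr (2 * \<alpha>) = Q \<alpha>" using pos \<open>\<alpha> > 0\<close> by (simp add: n_def powr_powr)
    ultimately show ?thesis by (simp add: powr_diff)
  qed
  moreover have "2 * \<alpha> * ln n = ln (Q \<alpha>)"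
    using pos \<open>\<alpha> > 0\<close> by (simp add: n_def ln_powr)
  moreover have "n * (- (1 / (2 * \<alpha>\<^sup>2)) * ln (Q \<alpha>) + d * (1 / (2 * \<alpha>)) / Q \<alpha>)
      = 1 / (2 * \<alpha>\<^sup>2) * (n / Q \<alpha>) * (\<alpha> * d - ln (Q \<alpha>) * Q \<alpha>)"
    using pos \<open>\<alpha> > 0\<close> by (simp add: field_simps power2_eq_square)
  ultimately show ?thesis by simp
qed

theorem theorem2p4:
  fixes f h g :: "complex \<Rightarrow> complex" and \<alpha> :: real
    and k :: nat and w c :: "nat \<Rightarrow> complex"
  assumes "f \<in> Ostar" and "\<alpha> > 1"
    and "h holomorphic_on ball 0 1"
    and "\<And>z. z \<in> ball 0 1 \<Longrightarrow> f z = exp (h z)"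
    and "\<And>i. i \<in> {1..k} \<Longrightarrow> w i \<in> ball 0 1"
    and "\<And>z. z \<in> ball 0 1 \<Longrightarrow>
      exp (of_real \<alpha> * h z) = (\<Sum>i=1..k. c i * (1 / (1 - cnj (w i) * z) powr of_real \<alpha>))"
    and "g holomorphic_on ball 0 1"
    and "\<And>z. z \<in> ball 0 1 \<Longrightarrow> exp (of_real \<alpha> * h z) = exp (g z)"
  shows "N f field_differentiable (at \<alpha>) \<and>
    complex_of_real (deriv (N f) \<alpha>) =
      1 / (2 * of_real \<alpha> ^ 2) * of_real (N f \<alpha> powr (1 - 2 * \<alpha>)) * D f \<alpha> k c w g"
proof -
  note f = \<open>f \<in> Ostar\<close> and \<alpha> = \<open>\<alpha> > 1\<close> and h = assms(3,4) and w = assms(5) and rep = assms(6)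
    and g = assms(7,8)
  obtain H R where R: "R > 1" and H: "H holomorphic_on ball 0 R"
    and Hh: "\<And>z. z \<in> ball 0 1 \<Longrightarrow> H z = h z"
    using Ostar_logarithm_extends[OF f h] by blast
  have mod: "cmod (w i) * cmod z < 1" if "i \<in> {1..k}" "z \<in> ball 0 1" for i z
    using w[OF that(1)] that(2) mult_strict_mono'[of "cmod (w i)" 1 "cmod z" 1] by simp
  have eq: "exp (of_real \<alpha> * H z) = (\<Sum>i=1..k. c i * bergman_kernel \<alpha> (w i) z)" if "z \<in> ball 0 1" for z
    unfolding Hh[OF that] rep[OF that]
    by (intro sum.cong refl arg_cong2[where f = "(*)"] bergman_kernel_powr mod that)

  define Q where "Q = (\<lambda>\<beta>. LINT z|bergman \<beta>. (cmod (exp (of_real \<beta> * H z)))\<^sup>2)"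
  define e where "e = (\<lambda>i j. c i * cnj (c j) * bergman_kernel \<alpha> (w i) (w j))"
  obtain d where d: "(Q has_real_derivative d) (at \<alpha>)"
    and d_val: "of_real d = (\<Sum>i=1..k. \<Sum>j=1..k. e i j * (cnj (H (w i)) + H (w j) + Ln (1 - cnj (w i) * w j)))"
    and Q_val: "of_real (Q \<alpha>) = (\<Sum>i=1..k. \<Sum>j=1..k. e i j)"
    unfolding Q_def e_def
    by (rule bergman_integral_derivative[of \<alpha> "{1..k}" w R H c]) (use \<alpha> w R H eq in auto)
  have Q_pos: "Q \<alpha> > 0"
    unfolding Q_def using \<alpha> R H by (rule bergman_integral_pos)

  have N: "N f \<beta> = Q \<beta> powr (1 / (2 * \<beta>))" if "\<beta> > 1" for \<beta>
    unfolding Q_def using that holomorphic_beyond_imp_continuous[OF R H] h(2)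
    by (intro N_eq_bergman_integral) (auto simp: Hh)
  define v where "v = 1 / (2 * \<alpha>\<^sup>2) * N f \<alpha> powr (1 - 2 * \<alpha>) * (\<alpha> * d - 2 * \<alpha> * ln (N f \<alpha>) * Q \<alpha>)"
  have der: "(N f has_real_derivative v) (at \<alpha>)"
  proof (rule has_field_derivative_transform_within_open[of "\<lambda>\<beta>. Q \<beta> powr (1 / (2 * \<beta>))" _ _ "{1<..}"])
    show "((\<lambda>\<beta>. Q \<beta> powr (1 / (2 * \<beta>))) has_real_derivative v) (at \<alpha>)"
      using root_derivative[OF d Q_pos] \<alpha> by (simp add: v_def N)
  qed (use \<alpha> N in auto)

  obtain n :: int where n: "\<And>z. z \<in> ball 0 1 \<Longrightarrow> g z = of_real \<alpha> * h z + 2 * of_int n * of_real pi * \<i>"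
    using g h(1) by (elim holomorphic_logarithm_unique[of "ball 0 1" g "\<lambda>z. of_real \<alpha> * h z", rotated 5])
      (auto intro!: holomorphic_intros)
  \<comment> \<open>The ambiguity \<open>2\<pi>\<i>n\<close> is the same at all points of the disc and purely imaginary, so it cancels
  against its conjugate.\<close>
  have log_sum: "cnj (g (w i)) + g (w j) = of_real \<alpha> * (cnj (H (w i)) + H (w j))"
    if "i \<in> {1..k}" "j \<in> {1..k}" for i j
    using n[OF w[OF that(1)]] n[OF w[OF that(2)]] Hh[OF w[OF that(1)]] Hh[OF w[OF that(2)]]
    by (simp add: algebra_simps)
  have N_pos: "N f \<alpha> > 0" using Q_pos by (simp add: N[OF \<alpha>])
  have "D f \<alpha> k c w g = (\<Sum>i=1..k. \<Sum>j=1..k. e i j *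
      (of_real \<alpha> * (cnj (H (w i)) + H (w j)) + of_real \<alpha> * Ln (1 - cnj (w i) * w j)
        - 2 * of_real \<alpha> * of_real (ln (N f \<alpha>))))"
    unfolding D_def e_def
    by (intro sum.cong refl)
       (simp add: bergman_kernel_powr[OF mod[OF _ w]] log_sum Ln_of_real[OF N_pos] del: atLeastAtMost_iff)
  also have "\<dots> = of_real (\<alpha> * d - 2 * \<alpha> * ln (N f \<alpha>) * Q \<alpha>)"
    by (simp add: d_val Q_val sum_distrib_left sum_subtractf[symmetric] algebra_simps)
  finally have "of_real v = 1 / (2 * of_real \<alpha> ^ 2) * of_real (N f \<alpha> powr (1 - 2 * \<alpha>)) * D f \<alpha> k c w g"
    by (simp add: v_def)
  moreover have "deriv (N f) \<alpha> = v" using der by (rule DERIV_imp_deriv)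
  ultimately show ?thesis
    using der by (auto simp: field_differentiable_def)
qed

end
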